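(* Let $\mathcal{H}$ be a nontrivial complex Hilbert space, let $A\in\mathcal{B}(\mathcal{H})$ be positive and nonzero, and let $T,S\in\mathcal{B}_{A^{1/2}}(\mathcal{H})$ with $m_A(S)>0$. Let $\{x_n\}$ be a sequence of $A$-unit vectors in $\mathcal{H}$ approximating the supremum $$\sup_{\|x\|_A=1}\left(\|Tx\|_A^2-\frac{|\langle Tx,Sx\rangle_A|^2}{\|Sx\|_A^2}\right),$$ i.e. such that $\|Tx_n\|_A^2-\frac{|\langle Tx_n,Sx_n\rangle_A|^2}{\|Sx_n\|_A^2}$ converges to this supremum as $n\to\infty$. Then $$c_A(T,S)=\lim_{n\to+\infty}\frac{\langle Tx_n,Sx_n\rangle_A}{\|Sx_n\|_A^2}.$$
   Context: $\mathcal{B}(\mathcal{H})$ denotes the bounded linear operators on $\mathcal{H}$. Positive means $\langle Ax,x\rangle\ge 0$ for all $x$. Put $\langle x,y\rangle_A=\langle Ax,y\rangle$ and $\|x\|_A=\sqrt{\langle x,x\rangle_A}$; $x$ is an $A$-unit vector if $\|x\|_A=1$. $\mathcal{B}_{A^{1/2}}(\mathcal{H})$ is the set of $A$-bounded operators, i.e. those $T\in\mathcal{B}(\mathcal{H})$ for which there is $c>0$ with $\|Tx\|_A\le c\|x\|_A$ for all $x\in\mathcal{H}$; for such $T$, $\|T\|_A=\sup\{\|Tx\|_A : x\in\mathcal{H},\ \|x\|_A=1\}$. The $A$-minimum modulus is $m_A(S)=\inf\{\|Sx\|_A : \|x\|_A=1\}$. The $A$-distance is $d_A(T,\mathbb{C}S)=\inf_{\gamma\in\mathbb{C}}\|T+\gamma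 S\|_A$. When $m_A(S)>0$, the $A$-center of mass of $T$ relative to $S$, $c_A(T,S)$, is the unique scalar $t_0\in\mathbb{C}$ with $\|T-t_0S\|_A=d_A(T,\mathbb{C}S)$. *)

theory Defs
  imports "HOL-Analysis.Analysis"
begin

text \<open>
  Complex Hilbert spaces, built on the library's real Banach spaces. The inner product is linear in
  the first argument, so that \<open>\<langle>Tx, Sx\<rangle>\<^sub>A / \<parallel>Sx\<parallel>\<^sub>A\<^sup>2\<close> is the
  coefficient of \<open>Tx\<close> along \<open>Sx\<close>. Positive definiteness of \<open>cinner\<close> comes from
  \<open>cinner_self\<close> and the norm axioms, completeness from \<open>banach\<close>.
\<close>

class chilbert_space = banach +
  fixes scaleC :: "complex \<Rightarrow> 'a \<Rightarrow> 'a" (infixr "*\<^sub>C" 75)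
    and cinner :: "'a \<Rightarrow> 'a \<Rightarrow> complex"
  assumes scaleC_add_right: "a *\<^sub>C (x + y) = a *\<^sub>C x + a *\<^sub>C y"
    and scaleC_add_left: "(a + b) *\<^sub>C x = a *\<^sub>C x + b *\<^sub>C x"
    and scaleC_scaleC: "a *\<^sub>C (b *\<^sub>C x) = (a * b) *\<^sub>C x"
    and scaleC_of_real: "complex_of_real r *\<^sub>C x = r *\<^sub>R x"
    and cinner_commute: "cinner x y = cnj (cinner y x)"
    and cinner_add_left: "cinner (x + y) z = cinner x z + cinner y z"
    and cinner_scaleC_left: "cinner (a *\<^sub>C x) y = a * cinner x y"
    and cinner_self: "cinner x x = complex_of_real ((norm x)\<^sup>2)"

instantiation complex :: chilbert_space
begin

definition scaleC_complex :: "complex \<Rightarrow> complex \<Rightarrow> complex"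
  where "scaleC_complex a x = a * x"

definition cinner_complex :: "complex \<Rightarrow> complex \<Rightarrow> complex"
  where "cinner_complex x y = x * cnj y"

instance
  by standard
    (simp_all add: scaleC_complex_def cinner_complex_def algebra_simps scaleR_conv_of_real
      flip: complex_norm_square)

end

definition bounded_clinear :: "('a::chilbert_space \<Rightarrow> 'a) \<Rightarrow> bool" where
  "bounded_clinear T \<longleftrightarrow>
     bounded_linear T \<and> (\<forall>a x. T (a *\<^sub>C x) = a *\<^sub>C T x)"

definition positive_op :: "('a::chilbert_space \<Rightarrow> 'a) \<Rightarrow> bool" where
  "positive_op A \<longleftrightarrow> (\<forall>x. cinner (A x) x \<in> \<real> \<and> 0 \<le> Re (cinner (A x) x))"

definition A_inner :: "('a::chilbert_space \<Rightarrow> 'a) \<Rightarrow> 'a \<Rightarrow> 'a \<Rightarrow> complex" where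
  "A_inner A x y = cinner (A x) y"

text \<open>For positive \<open>A\<close> the value \<open>A_inner A x x\<close> is real, so taking \<open>Re\<close> loses nothing.\<close>

definition A_norm :: "('a::chilbert_space \<Rightarrow> 'a) \<Rightarrow> 'a \<Rightarrow> real" where
  "A_norm A x = sqrt (Re (A_inner A x x))"

definition A_bounded :: "('a::chilbert_space \<Rightarrow> 'a) \<Rightarrow> ('a \<Rightarrow> 'a) \<Rightarrow> bool" where
  "A_bounded A T \<longleftrightarrow>
     bounded_clinear T \<and> (\<exists>c>0. \<forall>x. A_norm A (T x) \<le> c * A_norm A x)"

text \<open>
  The suprema and infima below are those of the reals; for nonzero positive \<open>A\<close> and
  \<open>A\<close>-bounded operators the sets involved are nonempty and bounded.
\<close>

definition A_opnorm :: "('a::chilbert_space \<Rightarrow> 'a) \<Rightarrow> ('a \<Rightarrow> 'a) \<Rightarrow> real" where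
  "A_opnorm A T = (SUP x\<in>{x. A_norm A x = 1}. A_norm A (T x))"

definition A_min_modulus :: "('a::chilbert_space \<Rightarrow> 'a) \<Rightarrow> ('a \<Rightarrow> 'a) \<Rightarrow> real" where
  "A_min_modulus A S = (INF x\<in>{x. A_norm A x = 1}. A_norm A (S x))"

definition A_dist :: "('a::chilbert_space \<Rightarrow> 'a) \<Rightarrow> ('a \<Rightarrow> 'a) \<Rightarrow> ('a \<Rightarrow> 'a) \<Rightarrow> real" where
  "A_dist A T S = (INF \<gamma>. A_opnorm A (\<lambda>x. T x + \<gamma> *\<^sub>C S x))"

text \<open>The minimiser exists and is unique when \<open>T\<close>, \<open>S\<close> are \<open>A\<close>-bounded and
  \<open>A_min_modulus A S > 0\<close>.\<close>

definition A_center :: "('a::chilbert_space \<Rightarrow> 'a) \<Rightarrow> ('a \<Rightarrow> 'a) \<Rightarrow> ('a \<Rightarrow> 'a) \<Rightarrow> complex" where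
  "A_center A T S = (THE t. A_opnorm A (\<lambda>x. T x - t *\<^sub>C S x) = A_dist A T S)"

end

theory Submission
  imports Defs
begin

text \<open>
  Write \<open>f(x) = \<parallel>Tx\<parallel>\<^sup>2 - |\<langle>Tx, Sx\<rangle>|\<^sup>2 / \<parallel>Sx\<parallel>\<^sup>2\<close> and
  \<open>t(x) = \<langle>Tx, Sx\<rangle> / \<parallel>Sx\<parallel>\<^sup>2\<close>, all with respect to \<open>A\<close>. Completing the square gives
  \<open>\<parallel>Tx - tSx\<parallel>\<^sup>2 = f(x) + |t - t(x)|\<^sup>2 \<parallel>Sx\<parallel>\<^sup>2\<close>. If \<open>\<parallel>T - t\<^sub>0S\<parallel> = d\<close> is minimal and
  \<open>sup f \<ge> d\<^sup>2\<close>, then \<open>f(x\<^sub>n) \<longlonglongrightarrow> sup f\<close> forces \<open>t(x\<^sub>n) \<longlonglongrightarrow> t\<^sub>0\<close>, which also shows that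
  the minimiser is unique. For \<open>sup f \<ge> d\<^sup>2\<close> one needs unit vectors \<open>v\<close> with \<open>\<parallel>Rv\<parallel>\<close> close to \<open>d\<close> and
  \<open>\<langle>Rv, Sv\<rangle>\<close> close to \<open>0\<close>, where \<open>R = T - t\<^sub>0S\<close>. The limits of \<open>\<langle>Rv, Sv\<rangle>\<close> along
  \<open>\<parallel>Rv\<parallel> \<longlonglongrightarrow> d\<close> form a closed set, which is convex by a Toeplitz--Hausdorff argument and meets every
  half plane with the origin on its boundary by minimality, so it contains \<open>0\<close>.
\<close>

section \<open>Complex scalars\<close>

lemma scaleC_zero_left [simp]: "0 *\<^sub>C x = (0::'a::chilbert_space)"
  using scaleC_add_left[of 0 0 x] by simp

lemma scaleC_minus_left: "(- a) *\<^sub>C x = - (a *\<^sub>C (x::'a::chilbert_space))"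
  using scaleC_add_left[of "- a" a x] by (simp add: eq_neg_iff_add_eq_0)

text \<open>The norm axioms speak of real scalars only; for complex ones the identity comes from
  \<open>cinner_self\<close> and conjugate symmetry.\<close>

lemma norm_scaleC: "norm (a *\<^sub>C x) = cmod a * norm (x::'a::chilbert_space)"
proof -
  have "complex_of_real ((norm (a *\<^sub>C x))\<^sup>2) = cinner (a *\<^sub>C x) (a *\<^sub>C x)"
    by (simp only: cinner_self)
  also have "\<dots> = a * cnj (a * cinner x x)"
    by (metis cinner_commute cinner_scaleC_left)
  also have "\<dots> = complex_of_real ((cmod a * norm x)\<^sup>2)"
    by (simp add: cinner_self power_mult_distrib mult.assoc[symmetric] flip: complex_norm_square)
  finally have "(norm (a *\<^sub>C x))\<^sup>2 = (cmod a * norm x)\<^sup>2"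
    using of_real_eq_iff by blast
  then show ?thesis
    by (simp add: power2_eq_iff_nonneg)
qed

lemma bounded_linear_scaleC: "bounded_linear (\<lambda>x::'a::chilbert_space. a *\<^sub>C x)"
proof (rule bounded_linear_intro[where K = "cmod a"])
  fix r :: real and x :: 'a
  have "a *\<^sub>C (complex_of_real r *\<^sub>C x) = complex_of_real r *\<^sub>C (a *\<^sub>C x)"
    by (simp only: scaleC_scaleC mult.commute)
  then show "a *\<^sub>C (r *\<^sub>R x) = r *\<^sub>R (a *\<^sub>C x)"
    by (simp only: scaleC_of_real)
qed (simp_all add: scaleC_add_right norm_scaleC mult.commute)

lemma bounded_clinear_add: "bounded_clinear T \<Longrightarrow> T (x + y) = T x + T y"
  by (simp add: bounded_clinear_def linear_add bounded_linear.linear)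

lemma bounded_clinear_scaleC: "bounded_clinear T \<Longrightarrow> T (a *\<^sub>C x) = a *\<^sub>C T x"
  by (simp add: bounded_clinear_def)

lemma bounded_clinear_diff_scaleC:
  assumes "bounded_clinear T" "bounded_clinear S"
  shows "bounded_clinear (\<lambda>x. T x - t *\<^sub>C S x)"
  unfolding bounded_clinear_def
proof (intro conjI allI)
  show "bounded_linear (\<lambda>x. T x - t *\<^sub>C S x)"
    using assms unfolding bounded_clinear_def
    by (intro bounded_linear_sub bounded_linear_compose[OF bounded_linear_scaleC]) auto
  show "T (a *\<^sub>C x) - t *\<^sub>C S (a *\<^sub>C x) = a *\<^sub>C (T x - t *\<^sub>C S x)" for a x
  proof -
    have "a *\<^sub>C (T x - t *\<^sub>C S x) + a *\<^sub>C (t *\<^sub>C S x) = a *\<^sub>C T x"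
      by (simp flip: scaleC_add_right)
    then have "a *\<^sub>C (T x - t *\<^sub>C S x) = a *\<^sub>C T x - a *\<^sub>C (t *\<^sub>C S x)"
      by (simp only: eq_diff_eq)
    then show ?thesis
      using assms by (simp add: bounded_clinear_scaleC scaleC_scaleC mult.commute)
  qed
qed

section \<open>Sesquilinear forms\<close>

text \<open>General enough for \<open>ip (R x) (S y)\<close>, which is linear in \<open>x\<close>,
  conjugate-linear in \<open>y\<close> and in general not Hermitian.\<close>

definition sesquilinear :: "('a::chilbert_space \<Rightarrow> 'a \<Rightarrow> complex) \<Rightarrow> bool" where
  "sesquilinear B \<longleftrightarrow>
     (\<forall>x y z. B (x + y) z = B x z + B y z) \<and> (\<forall>x y z. B x (y + z) = B x y + B x z) \<and>
     (\<forall>a x y. B (a *\<^sub>C x) y = a * B x y) \<and> (\<forall>a x y. B x (a *\<^sub>C y) = cnj a * B x y)"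

lemma sesquilinear_simps:
  assumes "sesquilinear B"
  shows "B (x + y) z = B x z + B y z" "B x (y + z) = B x y + B x z"
    "B (a *\<^sub>C x) y = a * B x y" "B x (a *\<^sub>C y) = cnj a * B x y"
  using assms by (simp_all add: sesquilinear_def)

text \<open>The imaginary part of \<open>cnj \<theta> * \<beta> + \<theta> * \<gamma>\<close> is
  that of \<open>\<theta> * (\<gamma> - cnj \<beta>)\<close>, so a phase rotating
  \<open>\<gamma> - cnj \<beta>\<close> onto the real axis serves. Its negative serves too, which
  leaves the sign free for the last condition.\<close>

lemma unit_phase_exists:
  fixes \<beta> \<gamma> g :: complex
  obtains \<theta> where "cmod \<theta> = 1" "cnj \<theta> * \<beta> + \<theta> * \<gamma> \<in> \<real>" "0 \<le> Re (cnj \<theta> * g)"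
proof -
  define d where "d = \<gamma> - cnj \<beta>"
  define \<phi> where "\<phi> = (if d = 0 then 1 else cnj (sgn d))"
  have \<phi>: "cmod \<phi> = 1" by (simp add: \<phi>_def norm_sgn)
  have "Im (\<phi> * d) = 0"
    by (simp add: \<phi>_def sgn_div_norm scaleR_conv_of_real)
  then have "Im (cnj \<phi> * \<beta> + \<phi> * \<gamma>) = 0"
    by (simp add: d_def algebra_simps)
  then have real: "Im (cnj (- \<phi>) * \<beta> + (- \<phi>) * \<gamma>) = 0" "Im (cnj \<phi> * \<beta> + \<phi> * \<gamma>) = 0"
    by simp_all
  show ?thesis
  proof (cases "0 \<le> Re (cnj \<phi> * g)")
    case True
    then show ?thesis using that[of \<phi>] \<phi> real by (simp add: complex_is_Real_iff)
  next
    case False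
    then show ?thesis using that[of "- \<phi>"] \<phi> real by (simp add: complex_is_Real_iff)
  qed
qed

section \<open>The semi-inner product of a positive operator\<close>

locale positive_operator =
  fixes A :: "'a::chilbert_space \<Rightarrow> 'a"
  assumes bounded_clinear_A: "bounded_clinear A" and positive_A: "positive_op A"
begin

abbreviation ip where "ip \<equiv> A_inner A"
abbreviation nm where "nm \<equiv> A_norm A"

lemma ip_add_left: "ip (x + y) z = ip x z + ip y z"
  by (simp add: A_inner_def bounded_clinear_add[OF bounded_clinear_A] cinner_add_left)

lemma ip_scaleC_left: "ip (a *\<^sub>C x) y = a * ip x y"
  by (simp add: A_inner_def bounded_clinear_scaleC[OF bounded_clinear_A] cinner_scaleC_left)

lemma ip_add_right: "ip x (y + z) = ip x y + ip x z"
  unfolding A_inner_def by (subst (1 2 3) cinner_commute) (simp add: cinner_add_left)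

lemma ip_scaleC_right: "ip x (a *\<^sub>C y) = cnj a * ip x y"
  unfolding A_inner_def by (subst (1 2) cinner_commute) (simp add: cinner_scaleC_left)

lemma sesquilinear_ip: "sesquilinear ip"
  by (simp add: sesquilinear_def ip_add_left ip_add_right ip_scaleC_left ip_scaleC_right)

lemma Im_ip_self [simp]: "Im (ip x x) = 0" and Re_ip_self_nonneg [simp]: "0 \<le> Re (ip x x)"
  using positive_A by (auto simp: positive_op_def A_inner_def complex_is_Real_iff)

lemma nm_nonneg [simp]: "0 \<le> nm x"
  by (simp add: A_norm_def)

lemma nm_sq: "(nm x)\<^sup>2 = Re (ip x x)"
  by (simp add: A_norm_def)

lemma ip_self: "ip x x = complex_of_real ((nm x)\<^sup>2)"
  by (simp add: nm_sq complex_eq_iff)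

text \<open>Over the complex numbers positivity forces the form to be Hermitian, by polarization.\<close>

lemma ip_commute: "ip x y = cnj (ip y x)"
proof -
  have "Im (ip (x + y) (x + y)) = 0" "Im (ip (x + \<i> *\<^sub>C y) (x + \<i> *\<^sub>C y)) = 0"
    by simp_all
  then show ?thesis
    unfolding ip_add_left ip_add_right ip_scaleC_left ip_scaleC_right
    by (simp add: complex_eq_iff)
qed

lemma nm_scaleC: "nm (a *\<^sub>C x) = cmod a * nm x"
proof -
  have "ip (a *\<^sub>C x) (a *\<^sub>C x) = complex_of_real ((cmod a)\<^sup>2 * (nm x)\<^sup>2)"
    unfolding of_real_mult complex_norm_square[of a] ip_self[of x, symmetric]
    by (simp add: ip_scaleC_left ip_scaleC_right)
  then have "(nm (a *\<^sub>C x))\<^sup>2 = (cmod a * nm x)\<^sup>2"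
    by (simp add: nm_sq[of "a *\<^sub>C x"] power_mult_distrib)
  then show ?thesis
    by (simp add: power2_eq_iff_nonneg)
qed

lemma diff_scaleC: "x - t *\<^sub>C y = x + (- t) *\<^sub>C (y::'a)"
  by (simp add: scaleC_minus_left)

lemma ip_diff_scaleC_left: "ip (x - t *\<^sub>C y) z = ip x z - t * ip y z"
  by (simp add: diff_scaleC ip_add_left ip_scaleC_left)

lemma nm_add_sq: "(nm (x + y))\<^sup>2 = (nm x)\<^sup>2 + 2 * Re (ip x y) + (nm y)\<^sup>2"
  using ip_commute[of y x] by (simp add: nm_sq ip_add_left ip_add_right)

lemma nm_diff_scaleC_sq:
  "(nm (x - t *\<^sub>C y))\<^sup>2 = (nm x)\<^sup>2 - 2 * Re (cnj t * ip x y) + (cmod t)\<^sup>2 * (nm y)\<^sup>2"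
  unfolding diff_scaleC by (simp add: nm_add_sq ip_scaleC_right nm_scaleC power_mult_distrib)

lemma parallelogram: "(nm (x + y))\<^sup>2 + (nm (x - y))\<^sup>2 = 2 * (nm x)\<^sup>2 + 2 * (nm y)\<^sup>2"
proof -
  have "x - y = x - 1 *\<^sub>C y" using scaleC_of_real[of 1 y] by simp
  then show ?thesis by (simp only: nm_add_sq nm_diff_scaleC_sq) simp
qed

text \<open>Completing the square: the first two terms give the squared seminorm of the part of
  \<open>x\<close> orthogonal to \<open>y\<close>, the last one measures how far \<open>t\<close> is
  from the coefficient of \<open>x\<close> along \<open>y\<close>.\<close>

lemma nm_diff_scaleC_sq_eq:
  assumes "nm y \<noteq> 0"
  shows "(nm (x - t *\<^sub>C y))\<^sup>2 =
    (nm x)\<^sup>2 - (cmod (ip x y))\<^sup>2 / (nm y)\<^sup>2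
      + (cmod (ip x y / complex_of_real ((nm y)\<^sup>2) - t))\<^sup>2 * (nm y)\<^sup>2"
proof -
  define p N where "p = ip x y" and "N = (nm y)\<^sup>2"
  have N: "N \<noteq> 0" using assms by (simp add: N_def)
  have "(cmod (p / complex_of_real N - t))\<^sup>2 * N
      = (cmod p)\<^sup>2 / N - 2 * Re (cnj t * p) + (cmod t)\<^sup>2 * N"
    using N unfolding cmod_power2 by (simp add: power2_eq_square field_simps)
  then show ?thesis
    unfolding nm_diff_scaleC_sq p_def[symmetric] N_def[symmetric] by simp
qed

lemma cauchy_schwarz: "cmod (ip x y) \<le> nm x * nm y"
proof (cases "nm y = 0")
  case True
  have "ip x y = 0"
  proof (rule ccontr)
    assume nz: "ip x y \<noteq> 0"
    \<comment> \<open>As \<open>nm y = 0\<close>, subtracting a multiple of \<open>y\<close> changes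
      the squared seminorm by a linear term only; this \<open>s\<close> makes that term outweigh
      \<open>(nm x)\<^sup>2\<close>, so that a square becomes negative.\<close>
    define s where "s = ((nm x)\<^sup>2 + 1) / (cmod (ip x y))\<^sup>2"
    have "cnj (of_real s * ip x y) * ip x y = of_real (s * (cmod (ip x y))\<^sup>2)"
      unfolding of_real_mult complex_norm_square by simp
    then have "Re (cnj (of_real s * ip x y) * ip x y) = (nm x)\<^sup>2 + 1"
      using nz by (simp add: s_def)
    then have "(nm (x - (of_real s * ip x y) *\<^sub>C y))\<^sup>2 = (nm x)\<^sup>2 - 2 * ((nm x)\<^sup>2 + 1)"
      using True by (simp only: nm_diff_scaleC_sq) simp
    then have "0 \<le> (nm x)\<^sup>2 - 2 * ((nm x)\<^sup>2 + 1)"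
      by (metis zero_le_power2)
    then have "(nm x)\<^sup>2 \<le> - 2"
      by simp
    then show False
      using zero_le_power2[of "nm x"] by linarith
  qed
  then show ?thesis by simp
next
  case False
  define t where "t = ip x y / complex_of_real ((nm y)\<^sup>2)"
  have "0 \<le> (nm (x - t *\<^sub>C y))\<^sup>2" by simp
  also have "\<dots> = (nm x)\<^sup>2 - (cmod (ip x y))\<^sup>2 / (nm y)\<^sup>2"
    by (simp add: nm_diff_scaleC_sq_eq[OF False] t_def)
  finally have "(cmod (ip x y))\<^sup>2 \<le> (nm x * nm y)\<^sup>2"
    using False by (simp add: field_simps power_mult_distrib)
  then show ?thesis
    by (rule power2_le_imp_le) simp
qed

lemma nm_triangle: "nm (x + y) \<le> nm x + nm y"
proof (rule power2_le_imp_le)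
  have "Re (ip x y) \<le> nm x * nm y"
    using cauchy_schwarz[of x y] complex_Re_le_cmod[of "ip x y"] by linarith
  then show "(nm (x + y))\<^sup>2 \<le> (nm x + nm y)\<^sup>2"
    by (simp add: nm_add_sq power2_sum)
qed simp

text \<open>
  The Toeplitz--Hausdorff argument. The phase \<open>\<theta>\<close> is chosen so that the cross terms help: this
  keeps the coefficients bounded even if \<open>x\<close> and \<open>y\<close> are almost parallel.
\<close>

lemma toeplitz_hausdorff:
  assumes B: "sesquilinear B" and x: "nm x = 1" and y: "nm y = 1"
    and l: "0 \<le> l" "l \<le> 1"
  obtains a b where "nm (a *\<^sub>C x + b *\<^sub>C y) = 1" "(cmod a)\<^sup>2 + (cmod b)\<^sup>2 \<le> 1"
    "B (a *\<^sub>C x + b *\<^sub>C y) (a *\<^sub>C x + b *\<^sub>C y) = (1 - of_real l) * B x x + of_real l * B y y"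
proof (cases "B x x = B y y")
  case True
  have "1 *\<^sub>C x + 0 *\<^sub>C y = x"
    using scaleC_of_real[of 1 x] by simp
  then show ?thesis
    using that[of 1 0] x True by (simp add: algebra_simps)
next
  case False
  define p q where "p = B x x" and "q = B y y"
  \<comment> \<open>The cross terms of the normalised form \<open>(B - p * ip) / (q - p)\<close>,
    which is 0 at \<open>x\<close> and 1 at \<open>y\<close>; the aim becomes the value
    \<open>l\<close> at a unit combination.\<close>
  define \<beta> where "\<beta> = (B x y - p * ip x y) / (q - p)"
  define \<gamma> where "\<gamma> = (B y x - p * ip y x) / (q - p)"
  have qp: "q - p \<noteq> 0" using False by (simp add: p_def q_def)
  obtain \<theta> where \<theta>: "cmod \<theta> = 1" "cnj \<theta> * \<beta> + \<theta> * \<gamma> \<in> \<real>" "0 \<le> Re (cnj \<theta> * ip x y)"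
    by (rule unit_phase_exists)
  then obtain \<kappa> where \<kappa>: "cnj \<theta> * \<beta> + \<theta> * \<gamma> = of_real \<kappa>"
    by (auto elim: Reals_cases)
  define \<rho> where "\<rho> = Re (cnj \<theta> * ip x y)"
  define N where "N = (\<lambda>s::real. (1 - s)\<^sup>2 + s\<^sup>2 + 2 * s * (1 - s) * \<rho>)"
  \<comment> \<open>At the vector \<open>v\<close> below the normalised form is
    \<open>s\<^sup>2 + s * (1 - s) * \<kappa>\<close> and the squared seminorm is
    \<open>N s\<close>. The difference is \<open>- l\<close> at \<open>s = 0\<close> and
    \<open>1 - l\<close> at \<open>s = 1\<close>, so it vanishes in between.\<close>
  have "\<exists>s\<ge>0. s \<le> 1 \<and> s\<^sup>2 + s * (1 - s) * \<kappa> - l * N s = 0"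
    using l by (intro IVT') (auto simp: N_def intro!: continuous_intros)
  then obtain s where s: "0 \<le> s" "s \<le> 1" "s\<^sup>2 + s * (1 - s) * \<kappa> = l * N s"
    by auto
  define v where "v = of_real (1 - s) *\<^sub>C x + (of_real s * \<theta>) *\<^sub>C y"
  have xx: "ip x x = 1" and yy: "ip y y = 1"
    using x y by (simp_all add: ip_self)
  have \<theta>\<theta>: "\<theta> * cnj \<theta> = 1"
    using \<theta>(1) complex_norm_square[of \<theta>] by simp
  have nv: "(nm v)\<^sup>2 = N s"
  proof -
    have "(nm v)\<^sup>2 = (1 - s)\<^sup>2 + 2 * Re (of_real (1 - s) * (cnj (of_real s * \<theta>) * ip x y)) + s\<^sup>2"
      unfolding v_def nm_add_sq nm_scaleC ip_scaleC_left ip_scaleC_right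
      using s x y \<theta>(1) by (simp add: norm_mult algebra_simps del: of_real_diff)
    also have "of_real (1 - s) * (cnj (of_real s * \<theta>) * ip x y)
        = of_real ((1 - s) * s) * (cnj \<theta> * ip x y)"
      by simp
    also have "Re \<dots> = (1 - s) * s * \<rho>"
      unfolding \<rho>_def by (simp add: algebra_simps)
    finally show ?thesis by (simp add: N_def algebra_simps)
  qed
  \<comment> \<open>Here the sign condition on the phase enters: without cancellation in
    \<open>N s\<close>, normalising \<open>v\<close> keeps the coefficients within the required
    bound.\<close>
  have N_ge: "(1 - s)\<^sup>2 + s\<^sup>2 \<le> N s"
    using s \<theta>(3) by (simp add: N_def \<rho>_def)
  have "0 < (1 - s)\<^sup>2 + s\<^sup>2"
    by (cases "s = 0") (auto intro: add_nonneg_pos)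
  with N_ge have N_pos: "0 < N s" by linarith
  have expand: "F v v = of_real ((1 - s)\<^sup>2) * F x x + of_real (s\<^sup>2) * F y y
      + of_real (s * (1 - s)) * (cnj \<theta> * F x y + \<theta> * F y x)" if "sesquilinear F" for F
  proof -
    have "F v v = of_real ((1 - s)\<^sup>2) * F x x + of_real (s\<^sup>2) * (\<theta> * cnj \<theta>) * F y y
      + of_real (s * (1 - s)) * (cnj \<theta> * F x y + \<theta> * F y x)"
      unfolding v_def by (simp add: sesquilinear_simps[OF that] algebra_simps power2_eq_square)
    then show ?thesis by (simp add: \<theta>\<theta>)
  qed
  have Bxy: "B x y = p * ip x y + (q - p) * \<beta>" "B y x = p * ip y x + (q - p) * \<gamma>"
    using qp by (simp_all add: \<beta>_def \<gamma>_def)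
  have "B v v = p * ip v v + (q - p) * (of_real (s\<^sup>2)
      + of_real (s * (1 - s)) * (cnj \<theta> * \<beta> + \<theta> * \<gamma>))"
    unfolding expand[OF B] expand[OF sesquilinear_ip] Bxy xx yy
    by (simp add: p_def[symmetric] q_def[symmetric] algebra_simps)
  also have "\<dots> = p * of_real (N s) + (q - p) * of_real (l * N s)"
    unfolding \<kappa> s(3)[symmetric] ip_self nv by simp
  finally have Bv: "B v v = of_real (N s) * ((1 - of_real l) * p + of_real l * q)"
    by (simp add: algebra_simps)
  define r where "r = 1 / sqrt (N s)"
  have r: "r\<^sup>2 = 1 / N s" "0 < r"
    using N_pos by (simp_all add: r_def power_divide)
  define a b where "a = of_real r * (of_real (1 - s) :: complex)"
    and "b = of_real r * (of_real s * \<theta>)"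
  have ab: "a *\<^sub>C x + b *\<^sub>C y = of_real r *\<^sub>C v"
    by (simp add: a_def b_def v_def scaleC_add_right scaleC_scaleC)
  show ?thesis
  proof (rule that[of a b])
    have "(nm (of_real r *\<^sub>C v))\<^sup>2 = 1"
      using N_pos r by (simp add: nm_scaleC power_mult_distrib nv)
    then show "nm (a *\<^sub>C x + b *\<^sub>C y) = 1"
      unfolding ab by (simp add: power2_eq_1_iff) (use nm_nonneg[of "of_real r *\<^sub>C v"] in linarith)
    have "(cmod a)\<^sup>2 + (cmod b)\<^sup>2 = r\<^sup>2 * ((1 - s)\<^sup>2 + s\<^sup>2)"
      using \<theta>(1) unfolding a_def b_def norm_mult norm_of_real
      by (simp add: power_mult_distrib algebra_simps)
    also have "\<dots> \<le> 1"
      using N_ge N_pos by (simp add: r)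
    finally show "(cmod a)\<^sup>2 + (cmod b)\<^sup>2 \<le> 1" .
    have "B (of_real r *\<^sub>C v) (of_real r *\<^sub>C v) = of_real (r\<^sup>2 * N s) * ((1 - of_real l) * p + of_real l * q)"
      by (simp add: sesquilinear_simps[OF B] Bv power2_eq_square)
    also have "r\<^sup>2 * N s = 1" using N_pos r by simp
    finally show "B (a *\<^sub>C x + b *\<^sub>C y) (a *\<^sub>C x + b *\<^sub>C y)
        = (1 - of_real l) * B x x + of_real l * B y y"
      unfolding ab p_def q_def by simp
  qed
qed


section \<open>Operators bounded with respect to the seminorm\<close>

lemma A_bounded_diff_scaleC:
  assumes T: "A_bounded A T" and S: "A_bounded A S"
  shows "A_bounded A (\<lambda>x. T x - t *\<^sub>C S x)"
proof -
  obtain c d where c: "c > 0" "\<And>x. nm (T x) \<le> c * nm x" and d: "d > 0" "\<And>x. nm (S x) \<le> d * nm x"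
    using T S unfolding A_bounded_def by blast
  have "nm (T x - t *\<^sub>C S x) \<le> (c + cmod t * d) * nm x" for x
  proof -
    have "nm (T x - t *\<^sub>C S x) \<le> nm (T x) + cmod t * nm (S x)"
      using nm_triangle[of "T x" "(- t) *\<^sub>C S x"] by (simp add: diff_scaleC nm_scaleC)
    also have "\<dots> \<le> c * nm x + cmod t * (d * nm x)"
      by (intro add_mono mult_left_mono c d) auto
    finally show ?thesis by (simp add: algebra_simps)
  qed
  moreover have "0 < c + cmod t * d"
    using c d by (simp add: add_pos_nonneg)
  ultimately show ?thesis
    using T S unfolding A_bounded_def by (blast intro: bounded_clinear_diff_scaleC)
qed

lemma bdd_above_A_opnorm:
  assumes "A_bounded A T"
  shows "bdd_above ((\<lambda>x. nm (T x)) ` {x. nm x = 1})"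
proof -
  obtain c where "\<And>x. nm (T x) \<le> c * nm x"
    using assms unfolding A_bounded_def by blast
  then show ?thesis
    by (intro bdd_aboveI2[where M = c]) (metis mem_Collect_eq mult.right_neutral)
qed

lemma nm_le_A_opnorm: "A_bounded A T \<Longrightarrow> nm x = 1 \<Longrightarrow> nm (T x) \<le> A_opnorm A T"
  unfolding A_opnorm_def by (rule cSUP_upper) (auto simp: bdd_above_A_opnorm)

lemma nm_le_A_opnorm_mult:
  assumes "A_bounded A T"
  shows "nm (T x) \<le> A_opnorm A T * nm x"
proof (cases "nm x = 0")
  \<comment> \<open>A vector of seminorm zero cannot be normalised, but boundedness sends it to one
    of seminorm zero.\<close>
  case True
  then show ?thesis
    using assms unfolding A_bounded_def by (metis mult_zero_right)
next
  case False
  define a where "a = complex_of_real (1 / nm x)"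
  have "cmod a = 1 / nm x"
    unfolding a_def norm_of_real by simp
  then have "nm (a *\<^sub>C x) = 1" and "nm (T (a *\<^sub>C x)) = nm (T x) / nm x"
    using False assms by (simp_all add: nm_scaleC A_bounded_def bounded_clinear_scaleC)
  then have "nm (T x) / nm x \<le> A_opnorm A T"
    using nm_le_A_opnorm[OF assms] by metis
  then show ?thesis
    using False nm_nonneg[of x] by (simp add: field_simps)
qed

text \<open>The vector \<open>u\<close> witnesses that the supremum ranges over a nonempty
  set.\<close>

lemma A_opnorm_le:
  assumes "nm u = 1" and "\<And>x. nm x = 1 \<Longrightarrow> nm (T x) \<le> c"
  shows "A_opnorm A T \<le> c"
  unfolding A_opnorm_def using assms by (intro cSUP_least) auto

lemma A_opnorm_nonneg:
  assumes "nm u = 1" and "A_bounded A T"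
  shows "0 \<le> A_opnorm A T"
  using nm_le_A_opnorm[OF assms(2,1)] nm_nonneg[of "T u"] by linarith

lemma less_A_opnorm:
  assumes "nm u = 1" and "A_bounded A T" and "c < A_opnorm A T"
  obtains x where "nm x = 1" and "c < nm (T x)"
proof -
  have "\<exists>x\<in>{x. nm x = 1}. c < nm (T x)"
    using assms bdd_above_A_opnorm[OF assms(2)] unfolding A_opnorm_def
    by (subst (asm) less_cSUP_iff) auto
  then show ?thesis using that by auto
qed

lemma sesquilinear_ip_compose:
  assumes "A_bounded A R" and "A_bounded A S"
  shows "sesquilinear (\<lambda>x y. ip (R x) (S y))"
  using assms unfolding A_bounded_def sesquilinear_def
  by (simp add: bounded_clinear_add bounded_clinear_scaleC
      ip_add_left ip_add_right ip_scaleC_left ip_scaleC_right)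

section \<open>The maximal numerical range of a pair\<close>

text \<open>For bounded \<open>R\<close> these are the limits of \<open>ip (R v) (S v)\<close> along
  unit vectors with \<open>nm (R v)\<close> tending to the operator seminorm. With \<open>A\<close>
  and \<open>S\<close> the identity this is Stampfli's maximal numerical range.\<close>

definition max_range :: "('a \<Rightarrow> 'a) \<Rightarrow> ('a \<Rightarrow> 'a) \<Rightarrow> complex set" where
  "max_range R S = {z. \<forall>e>0. \<exists>v. nm v = 1 \<and> (A_opnorm A R)\<^sup>2 - e < (nm (R v))\<^sup>2
     \<and> cmod (ip (R v) (S v) - z) < e}"

lemma max_rangeD:
  assumes "z \<in> max_range R S" and "0 < e"
  obtains v where "nm v = 1" "(A_opnorm A R)\<^sup>2 - e < (nm (R v))\<^sup>2" "cmod (ip (R v) (S v) - z) < e"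
  using assms unfolding max_range_def by blast

lemma closed_max_range: "closed (max_range R S)"
proof -
  have "z \<in> max_range R S" if z: "z \<in> closure (max_range R S)" for z
    unfolding max_range_def
  proof (intro CollectI allI impI)
    fix e :: real assume e: "0 < e"
    then have "0 < e / 2" by simp
    obtain w where w: "w \<in> max_range R S" "dist w z < e / 2"
      using z \<open>0 < e / 2\<close> unfolding closure_approachable by blast
    obtain v where v: "nm v = 1" "(A_opnorm A R)\<^sup>2 - e / 2 < (nm (R v))\<^sup>2"
        "cmod (ip (R v) (S v) - w) < e / 2"
      using max_rangeD[OF w(1) \<open>0 < e / 2\<close>] .
    have "cmod (ip (R v) (S v) - z) < e"
      using v(3) w(2) norm_diff_triangle_less[of _ w "e/2" z "e/2"] by (simp add: dist_norm)
    then show "\<exists>v. nm v = 1 \<and> (A_opnorm A R)\<^sup>2 - e < (nm (R v))\<^sup>2 \<and> cmod (ip (R v) (S v) - z) < e"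
      using v(1,2) e by (intro exI[of _ v]) auto
  qed
  then show ?thesis
    by (metis closure_subset closure_eq subsetI subset_antisym)
qed

text \<open>
  The form \<open>\<parallel>R\<parallel>\<^sup>2 \<parallel>v\<parallel>\<^sup>2 - \<parallel>R v\<parallel>\<^sup>2\<close> is positive, so by the
  parallelogram law it stays small on combinations of two vectors on which it is small.
\<close>

lemma opnorm_defect_combination:
  assumes R: "A_bounded A R"
    and u: "nm u = 1" "(A_opnorm A R)\<^sup>2 - e \<le> (nm (R u))\<^sup>2"
    and w: "nm w = 1" "(A_opnorm A R)\<^sup>2 - e \<le> (nm (R w))\<^sup>2"
    and ab: "(cmod a)\<^sup>2 + (cmod b)\<^sup>2 \<le> 1" "nm (a *\<^sub>C u + b *\<^sub>C w) = 1" and e: "0 \<le> e"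
  shows "(A_opnorm A R)\<^sup>2 - 2 * e \<le> (nm (R (a *\<^sub>C u + b *\<^sub>C w)))\<^sup>2"
proof -
  define d where "d = A_opnorm A R"
  let ?p = "a *\<^sub>C u" and ?q = "b *\<^sub>C w"
  have lin: "bounded_clinear R" using R by (simp add: A_bounded_def)
  have R_diff: "R (?p - ?q) = R ?p - R ?q"
    using lin by (simp add: bounded_clinear_def linear_diff bounded_linear.linear)
  have "nm (R (?p - ?q)) \<le> d * nm (?p - ?q)"
    unfolding d_def by (rule nm_le_A_opnorm_mult[OF R])
  then have "(nm (R (?p - ?q)))\<^sup>2 \<le> d\<^sup>2 * (nm (?p - ?q))\<^sup>2"
    unfolding power_mult_distrib[symmetric] by (rule power_mono) simp
  moreover have "(nm (R (?p + ?q)))\<^sup>2 + (nm (R (?p - ?q)))\<^sup>2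
      = 2 * ((cmod a)\<^sup>2 * (nm (R u))\<^sup>2) + 2 * ((cmod b)\<^sup>2 * (nm (R w))\<^sup>2)"
    unfolding R_diff bounded_clinear_add[OF lin] parallelogram
    by (simp add: bounded_clinear_scaleC[OF lin] nm_scaleC power_mult_distrib)
  moreover have "d\<^sup>2 * (nm (?p - ?q))\<^sup>2
      = 2 * ((cmod a)\<^sup>2 * d\<^sup>2) + 2 * ((cmod b)\<^sup>2 * d\<^sup>2) - d\<^sup>2"
    using arg_cong[OF parallelogram[of ?p ?q], of "\<lambda>t. d\<^sup>2 * t"] u(1) w(1) ab(2)
    by (simp add: nm_scaleC power_mult_distrib algebra_simps)
  moreover have "(cmod a)\<^sup>2 * d\<^sup>2 - (cmod a)\<^sup>2 * e \<le> (cmod a)\<^sup>2 * (nm (R u))\<^sup>2"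
      "(cmod b)\<^sup>2 * d\<^sup>2 - (cmod b)\<^sup>2 * e \<le> (cmod b)\<^sup>2 * (nm (R w))\<^sup>2"
    using u(2) w(2) by (simp_all add: d_def mult_left_mono flip: right_diff_distrib)
  moreover have "(cmod a)\<^sup>2 * e + (cmod b)\<^sup>2 * e \<le> e"
    using mult_right_mono[OF ab(1) e] by (simp add: algebra_simps)
  ultimately show ?thesis
    unfolding d_def[symmetric] by linarith
qed

text \<open>For nearly maximising vectors belonging to two points, \<open>toeplitz_hausdorff\<close>
  yields a unit combination whose form value is exactly the convex combination, and its coefficient
  bound lets \<open>opnorm_defect_combination\<close> keep that vector nearly maximising.\<close>

lemma convex_max_range:
  assumes R: "A_bounded A R" and S: "A_bounded A S"
  shows "convex (max_range R S)"
  unfolding convex_alt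
proof (intro ballI allI impI)
  fix z w :: complex and l :: real
  assume z: "z \<in> max_range R S" and w: "w \<in> max_range R S" and l: "0 \<le> l \<and> l \<le> 1"
  show "(1 - l) *\<^sub>R z + l *\<^sub>R w \<in> max_range R S"
    unfolding max_range_def
  proof (intro CollectI allI impI)
    fix e :: real assume e: "0 < e"
    then have e': "0 < e / 4" by simp
    obtain x where x: "nm x = 1" "(A_opnorm A R)\<^sup>2 - e / 4 < (nm (R x))\<^sup>2"
        "cmod (ip (R x) (S x) - z) < e / 4"
      using max_rangeD[OF z e'] .
    obtain y where y: "nm y = 1" "(A_opnorm A R)\<^sup>2 - e / 4 < (nm (R y))\<^sup>2"
        "cmod (ip (R y) (S y) - w) < e / 4"
      using max_rangeD[OF w e'] .
    obtain a b where ab: "nm (a *\<^sub>C x + b *\<^sub>C y) = 1" "(cmod a)\<^sup>2 + (cmod b)\<^sup>2 \<le> 1"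
      and B: "ip (R (a *\<^sub>C x + b *\<^sub>C y)) (S (a *\<^sub>C x + b *\<^sub>C y))
        = (1 - of_real l) * ip (R x) (S x) + of_real l * ip (R y) (S y)"
      using toeplitz_hausdorff[OF sesquilinear_ip_compose[OF R S] x(1) y(1), of l] l by blast
    let ?v = "a *\<^sub>C x + b *\<^sub>C y"
    have "(A_opnorm A R)\<^sup>2 - 2 * (e / 4) \<le> (nm (R ?v))\<^sup>2"
      using opnorm_defect_combination[OF R x(1) _ y(1) _ ab(2,1), of "e / 4"] x y e by simp
    then have "(A_opnorm A R)\<^sup>2 - e < (nm (R ?v))\<^sup>2"
      using e by simp
    moreover have "cmod (ip (R ?v) (S ?v) - ((1 - l) *\<^sub>R z + l *\<^sub>R w)) < e"
    proof -
      have "ip (R ?v) (S ?v) - ((1 - l) *\<^sub>R z + l *\<^sub>R w)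
          = (1 - l) *\<^sub>R (ip (R x) (S x) - z) + l *\<^sub>R (ip (R y) (S y) - w)"
        by (simp add: B scaleR_conv_of_real algebra_simps)
      also have "cmod \<dots> \<le> (1 - l) * cmod (ip (R x) (S x) - z) + l * cmod (ip (R y) (S y) - w)"
        using l by (intro order_trans[OF norm_triangle_ineq]) simp
      also have "\<dots> \<le> (1 - l) * (e / 4) + l * (e / 4)"
        using x(3) y(3) l by (intro add_mono mult_left_mono) auto
      also have "\<dots> = e / 4"
        by (simp add: field_simps)
      also have "\<dots> < e"
        using e by simp
      finally show ?thesis .
    qed
    ultimately show "\<exists>v. nm v = 1 \<and> (A_opnorm A R)\<^sup>2 - e < (nm (R v))\<^sup>2
        \<and> cmod (ip (R v) (S v) - ((1 - l) *\<^sub>R z + l *\<^sub>R w)) < e"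
      using ab(1) by blast
  qed
qed

text \<open>By Cauchy-Schwarz the form values stay in a bounded part of the plane, so
  Bolzano-Weierstrass turns any maximising sequence into a point of
  \<open>max_range\<close>.\<close>

lemma max_range_limit:
  assumes R: "A_bounded A R" and S: "A_bounded A S"
    and v: "\<And>n. nm (v n) = 1" and lim: "(\<lambda>n. (nm (R (v n)))\<^sup>2) \<longlonglongrightarrow> (A_opnorm A R)\<^sup>2"
  obtains r z where "strict_mono r" "z \<in> max_range R S" "(\<lambda>n. ip (R (v (r n))) (S (v (r n)))) \<longlonglongrightarrow> z"
proof -
  define f where "f n = ip (R (v n)) (S (v n))" for n
  have "cmod (f n) \<le> A_opnorm A R * A_opnorm A S" for n
  proof -
    have "cmod (f n) \<le> nm (R (v n)) * nm (S (v n))"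
      unfolding f_def by (rule cauchy_schwarz)
    also have "\<dots> \<le> A_opnorm A R * A_opnorm A S"
      using v by (intro mult_mono nm_le_A_opnorm R S A_opnorm_nonneg[of "v n"]) auto
    finally show ?thesis .
  qed
  then have "bounded (range f)"
    by (auto intro!: boundedI)
  then obtain z r where r: "strict_mono r" and z: "(f \<circ> r) \<longlonglongrightarrow> z"
    using bounded_imp_convergent_subsequence by blast
  have "z \<in> max_range R S"
    unfolding max_range_def
  proof (intro CollectI allI impI)
    fix e :: real assume e: "0 < e"
    have "\<forall>\<^sub>F n in sequentially. (A_opnorm A R)\<^sup>2 - e < (nm (R (v (r n))))\<^sup>2"
      using LIMSEQ_subseq_LIMSEQ[OF lim r] e
      by (intro order_tendstoD) (auto simp: o_def)
    moreover have "\<forall>\<^sub>F n in sequentially. cmod (f (r n) - z) < e"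
      using tendstoD[OF z e] by (simp add: dist_norm)
    ultimately have "\<forall>\<^sub>F n in sequentially. (A_opnorm A R)\<^sup>2 - e < (nm (R (v (r n))))\<^sup>2
        \<and> cmod (f (r n) - z) < e"
      by (rule eventually_conj)
    then obtain n where "(A_opnorm A R)\<^sup>2 - e < (nm (R (v (r n))))\<^sup>2" "cmod (f (r n) - z) < e"
      by (auto simp: eventually_sequentially)
    then show "\<exists>v. nm v = 1 \<and> (A_opnorm A R)\<^sup>2 - e < (nm (R v))\<^sup>2 \<and> cmod (ip (R v) (S v) - z) < e"
      using v unfolding f_def by blast
  qed
  then show ?thesis
    using that r z by (simp add: f_def o_def)
qed

text \<open>
  Testing minimality against \<open>R - t a S\<close> for small \<open>t > 0\<close> shows that the maximal numerical
  range meets every half plane bounded by a line through the origin.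
\<close>

lemma max_range_half_plane:
  assumes R: "A_bounded A R" and S: "A_bounded A S" and unit: "nm u = 1"
    and min: "\<And>t. A_opnorm A R \<le> A_opnorm A (\<lambda>x. R x - t *\<^sub>C S x)"
    and a: "cmod a = 1"
  shows "\<exists>z\<in>max_range R S. a \<bullet> z \<le> 0"
proof -
  define d where "d = A_opnorm A R"
  define s where "s = A_opnorm A S"
  define \<delta> where "\<delta> n = inverse (real (Suc n))" for n
  have d: "0 \<le> d" and s: "0 \<le> s"
    using A_opnorm_nonneg[OF unit] R S by (auto simp: d_def s_def)
  have \<delta>: "0 < \<delta> n" for n by (simp add: \<delta>_def)
  \<comment> \<open>Nearly maximising vectors for the perturbed operator. The tolerance is of second
    order in \<open>\<delta> n\<close>, so that after division by \<open>\<delta> n\<close> the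
    bound on \<open>a \<bullet> f n\<close> still tends to 0.\<close>
  have "\<exists>v. nm v = 1 \<and> d\<^sup>2 - (\<delta> n)\<^sup>2 < (nm (R v - (\<delta> n *\<^sub>R a) *\<^sub>C S v))\<^sup>2" for n
  proof (cases "d = 0")
    case True
    have "0 < (\<delta> n)\<^sup>2" "d\<^sup>2 = 0" using \<delta>[of n] True by simp_all
    then have "d\<^sup>2 - (\<delta> n)\<^sup>2 < (nm (R u - (\<delta> n *\<^sub>R a) *\<^sub>C S u))\<^sup>2"
      using zero_le_power2[of "nm (R u - (\<delta> n *\<^sub>R a) *\<^sub>C S u)"] by linarith
    then show ?thesis using unit by blast
  next
    case False
    \<comment> \<open>The truncation covers the case that \<open>\<delta> n\<close> exceeds
      \<open>d\<close>; the strict inequality needs \<open>0 < d\<close>, hence the case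
      split.\<close>
    have "sqrt (max 0 (d\<^sup>2 - (\<delta> n)\<^sup>2)) < sqrt (d\<^sup>2)"
      using \<delta>[of n] False by (intro real_sqrt_less_mono) simp
    also have "\<dots> = d" using d by simp
    also have "\<dots> \<le> A_opnorm A (\<lambda>x. R x - (\<delta> n *\<^sub>R a) *\<^sub>C S x)"
      unfolding d_def by (rule min)
    finally obtain v where v: "nm v = 1"
        "sqrt (max 0 (d\<^sup>2 - (\<delta> n)\<^sup>2)) < nm (R v - (\<delta> n *\<^sub>R a) *\<^sub>C S v)"
      by (rule less_A_opnorm[OF unit A_bounded_diff_scaleC[OF R S]])
    then have "(sqrt (max 0 (d\<^sup>2 - (\<delta> n)\<^sup>2)))\<^sup>2 < (nm (R v - (\<delta> n *\<^sub>R a) *\<^sub>C S v))\<^sup>2"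
      by (intro power_strict_mono) auto
    then have "max 0 (d\<^sup>2 - (\<delta> n)\<^sup>2) < (nm (R v - (\<delta> n *\<^sub>R a) *\<^sub>C S v))\<^sup>2"
      by simp
    then show ?thesis using v(1) by auto
  qed
  then obtain v where v: "\<And>n. nm (v n) = 1"
    and v_ge: "\<And>n. d\<^sup>2 - (\<delta> n)\<^sup>2 < (nm (R (v n) - (\<delta> n *\<^sub>R a) *\<^sub>C S (v n)))\<^sup>2"
    by metis
  define f where "f n = ip (R (v n)) (S (v n))" for n
  have Rv: "(nm (R (v n)))\<^sup>2 \<le> d\<^sup>2" and Sv: "(nm (S (v n)))\<^sup>2 \<le> s\<^sup>2" for n
    using nm_le_A_opnorm[OF R v] nm_le_A_opnorm[OF S v]
    by (auto simp: d_def s_def intro!: power_mono)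
  have expand: "d\<^sup>2 - (\<delta> n)\<^sup>2 < (nm (R (v n)))\<^sup>2 - 2 * \<delta> n * (a \<bullet> f n) + (\<delta> n)\<^sup>2 * s\<^sup>2" for n
  proof -
    have "(cmod (\<delta> n *\<^sub>R a))\<^sup>2 * (nm (S (v n)))\<^sup>2 \<le> (\<delta> n)\<^sup>2 * s\<^sup>2"
      using a Sv by (simp add: mult_left_mono)
    moreover have "Re (cnj (\<delta> n *\<^sub>R a) * ip (R (v n)) (S (v n))) = \<delta> n * (a \<bullet> f n)"
      by (simp add: f_def inner_complex_def algebra_simps)
    ultimately show ?thesis
      using v_ge[of n] unfolding nm_diff_scaleC_sq by linarith
  qed
  have f_le: "a \<bullet> f n \<le> \<delta> n * (1 + s\<^sup>2)" for n
  proof -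
    have "\<delta> n * (2 * (a \<bullet> f n)) \<le> \<delta> n * (\<delta> n * (1 + s\<^sup>2))"
      using expand[of n] Rv[of n] by (simp add: algebra_simps power2_eq_square)
    then have "2 * (a \<bullet> f n) \<le> \<delta> n * (1 + s\<^sup>2)"
      using \<delta>[of n] by simp
    moreover have "0 \<le> \<delta> n * (1 + s\<^sup>2)"
      using \<delta>[of n] by simp
    ultimately show ?thesis by linarith
  qed
  \<comment> \<open>This crude bound makes the first-order term in \<open>expand\<close> vanish in
    the limit, so that \<open>v\<close> is a maximising sequence for \<open>R\<close>
    itself.\<close>
  have f_ge: "- (d * s) \<le> a \<bullet> f n" for n
  proof -
    have "\<bar>a \<bullet> f n\<bar> \<le> cmod a * cmod (f n)"
      by (rule Cauchy_Schwarz_ineq2)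
    also have "\<dots> \<le> nm (R (v n)) * nm (S (v n))"
      using a cauchy_schwarz by (simp add: f_def)
    also have "\<dots> \<le> d * s"
      unfolding d_def s_def using v
      by (intro mult_mono nm_le_A_opnorm R S A_opnorm_nonneg[OF unit]) auto
    finally show ?thesis by linarith
  qed
  have \<delta>_lim: "\<delta> \<longlonglongrightarrow> 0"
    unfolding \<delta>_def by (rule LIMSEQ_inverse_real_of_nat)
  have "(\<lambda>n. (nm (R (v n)))\<^sup>2) \<longlonglongrightarrow> d\<^sup>2"
  proof (rule tendsto_sandwich[where h = "\<lambda>_. d\<^sup>2"])
    show "(\<lambda>n. d\<^sup>2 - (\<delta> n)\<^sup>2 - (\<delta> n)\<^sup>2 * s\<^sup>2 - 2 * \<delta> n * (d * s)) \<longlonglongrightarrow> d\<^sup>2"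
      by (rule tendsto_eq_intros \<delta>_lim refl)+ simp
    have "d\<^sup>2 - (\<delta> n)\<^sup>2 - (\<delta> n)\<^sup>2 * s\<^sup>2 - 2 * \<delta> n * (d * s) \<le> (nm (R (v n)))\<^sup>2" for n
    proof -
      have "(2 * \<delta> n) * (- (d * s)) \<le> (2 * \<delta> n) * (a \<bullet> f n)"
        using \<delta>[of n] f_ge[of n] by (intro mult_left_mono) auto
      then have "- (2 * \<delta> n * (d * s)) \<le> 2 * \<delta> n * (a \<bullet> f n)"
        by simp
      then show ?thesis using expand[of n] by linarith
    qed
    then show "\<forall>\<^sub>F n in sequentially.
        d\<^sup>2 - (\<delta> n)\<^sup>2 - (\<delta> n)\<^sup>2 * s\<^sup>2 - 2 * \<delta> n * (d * s) \<le> (nm (R (v n)))\<^sup>2"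
      by simp
  qed (use Rv in simp_all)
  then obtain r z where r: "strict_mono r" and z: "z \<in> max_range R S"
    and lim: "(\<lambda>n. f (r n)) \<longlonglongrightarrow> z"
    unfolding d_def f_def by (rule max_range_limit[OF R S v])
  have "a \<bullet> z \<le> 0"
  proof (rule LIMSEQ_le)
    show "(\<lambda>n. a \<bullet> f (r n)) \<longlonglongrightarrow> a \<bullet> z"
      by (intro tendsto_intros lim)
    have "(\<lambda>n. \<delta> (r n)) \<longlonglongrightarrow> 0"
      using LIMSEQ_subseq_LIMSEQ[OF \<delta>_lim r] by (simp add: o_def)
    then show "(\<lambda>n. \<delta> (r n) * (1 + s\<^sup>2)) \<longlonglongrightarrow> 0"
      by (rule tendsto_mult_left_zero)
  qed (use f_le in blast)
  with z show ?thesis by blast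
qed

text \<open>A closed convex set missing 0 is strictly separated from it by some normal
  \<open>a\<close>; the half plane lemma for the direction \<open>sgn a\<close> contradicts
  this.\<close>

lemma zero_in_max_range:
  assumes R: "A_bounded A R" and S: "A_bounded A S" and unit: "nm u = 1"
    and min: "\<And>t. A_opnorm A R \<le> A_opnorm A (\<lambda>x. R x - t *\<^sub>C S x)"
  shows "0 \<in> max_range R S"
proof (rule ccontr)
  assume "0 \<notin> max_range R S"
  moreover have "max_range R S \<noteq> {}"
    using max_range_half_plane[OF R S unit min, of 1] by auto
  ultimately obtain a b where ab: "0 < b" "\<And>z. z \<in> max_range R S \<Longrightarrow> b < a \<bullet> z"
    using separating_hyperplane_closed_point[OF convex_max_range[OF R S] closed_max_range, of 0]
    by (metis inner_zero_right)
  \<comment> \<open>With a point of the set at hand, \<open>a = 0\<close> would give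
    \<open>b < 0\<close>.\<close>
  obtain z0 where "z0 \<in> max_range R S"
    using \<open>max_range R S \<noteq> {}\<close> by blast
  then have "a \<noteq> 0" using ab by fastforce
  then obtain z where z: "z \<in> max_range R S" "sgn a \<bullet> z \<le> 0"
    using max_range_half_plane[OF R S unit min, of "sgn a"] by (auto simp: norm_sgn)
  have "a \<bullet> z = norm a * (sgn a \<bullet> z)"
    using \<open>a \<noteq> 0\<close> by (simp add: sgn_div_norm)
  then have "a \<bullet> z \<le> 0"
    using z(2) by (simp add: mult_nonneg_nonpos)
  then show False
    using ab z(1) by fastforce
qed

section \<open>The center of mass\<close>

text \<open>The squared seminorm distance from \<open>T v\<close> to the complex line spanned by
  \<open>S v\<close>, when \<open>nm (S v)\<close> is nonzero.\<close>

definition residual :: "('a \<Rightarrow> 'a) \<Rightarrow> ('a \<Rightarrow> 'a) \<Rightarrow> 'a \<Rightarrow> real" where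
  "residual T S v = (nm (T v))\<^sup>2 - (cmod (ip (T v) (S v)))\<^sup>2 / (nm (S v))\<^sup>2"

lemma A_min_modulus_le: "nm v = 1 \<Longrightarrow> A_min_modulus A S \<le> nm (S v)"
  unfolding A_min_modulus_def by (rule cINF_lower) (auto intro: bdd_belowI2[where m = 0])

text \<open>A positive minimum modulus keeps \<open>nm (S v)\<close> away from 0, so the completed
  square applies; \<open>t\<close> stays free so that it can be set to a minimiser.\<close>

lemma residual_eq:
  assumes "0 < A_min_modulus A S" and "nm v = 1"
  shows "residual T S v = (nm (T v - t *\<^sub>C S v))\<^sup>2
    - (cmod (ip (T v) (S v) / complex_of_real ((nm (S v))\<^sup>2) - t))\<^sup>2 * (nm (S v))\<^sup>2"
proof -
  have "nm (S v) \<noteq> 0"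
    using assms A_min_modulus_le[of v S] by auto
  then show ?thesis
    by (simp add: nm_diff_scaleC_sq_eq residual_def)
qed

lemma bdd_above_residual:
  assumes T: "A_bounded A T"
  shows "bdd_above (residual T S ` {v. nm v = 1})"
proof (rule bdd_aboveI2)
  fix v assume "v \<in> {v. nm v = 1}"
  then have "(nm (T v))\<^sup>2 \<le> (A_opnorm A T)\<^sup>2"
    using nm_le_A_opnorm[OF T] by (simp add: power_mono)
  moreover have "0 \<le> (cmod (ip (T v) (S v)))\<^sup>2 / (nm (S v))\<^sup>2"
    by simp
  ultimately show "residual T S v \<le> (A_opnorm A T)\<^sup>2"
    unfolding residual_def by linarith
qed

text \<open>As 0 lies in the maximal range of \<open>T - t0 S\<close>, some nearly maximising vector
  is sent by \<open>T - t0 S\<close> almost orthogonally to its image under \<open>S\<close>. There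
  the residual differs little from the squared operator seminorm.\<close>

lemma A_opnorm_sq_le_SUP_residual:
  assumes T: "A_bounded A T" and S: "A_bounded A S" and unit: "nm u = 1"
    and m: "0 < A_min_modulus A S"
    and min: "\<And>t. A_opnorm A (\<lambda>x. T x - t0 *\<^sub>C S x) \<le> A_opnorm A (\<lambda>x. T x - t *\<^sub>C S x)"
  shows "(A_opnorm A (\<lambda>x. T x - t0 *\<^sub>C S x))\<^sup>2 \<le> (SUP v\<in>{v. nm v = 1}. residual T S v)"
proof (rule field_le_epsilon)
  fix e :: real assume e: "0 < e"
  define R where "R = (\<lambda>x. T x - t0 *\<^sub>C S x)"
  define m where "m = A_min_modulus A S"
  have m: "0 < m" using assms by (simp add: m_def)
  have R: "A_bounded A R" unfolding R_def by (rule A_bounded_diff_scaleC[OF T S])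
  \<comment> \<open>Shifting by \<open>t0\<close> turns minimality at \<open>t0\<close> into
    minimality at 0.\<close>
  have "A_opnorm A R \<le> A_opnorm A (\<lambda>x. R x - t *\<^sub>C S x)" for t
  proof -
    have "(\<lambda>x. R x - t *\<^sub>C S x) = (\<lambda>x. T x - (t0 + t) *\<^sub>C S x)"
      by (simp add: R_def scaleC_add_left diff_diff_eq)
    then show ?thesis using min[of "t0 + t"] by (simp add: R_def)
  qed
  then have zero: "0 \<in> max_range R S"
    by (rule zero_in_max_range[OF R S unit])
  \<comment> \<open>Each bound costs half of \<open>e\<close>: the first in the norm of
    \<open>R v\<close>, the second in
    \<open>(cmod (ip (R v) (S v)))\<^sup>2 / (nm (S v))\<^sup>2\<close>, whose denominator is at
    least \<open>m\<^sup>2\<close>.\<close>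
  define \<eta> where "\<eta> = Min {e / 2, m * sqrt (e / 2)}"
  have \<eta>: "0 < \<eta>" "\<eta> \<le> e / 2" "\<eta> \<le> m * sqrt (e / 2)"
    using e m by (auto simp: \<eta>_def)
  obtain v where v: "nm v = 1" "(A_opnorm A R)\<^sup>2 - \<eta> < (nm (R v))\<^sup>2" "cmod (ip (R v) (S v)) < \<eta>"
    using max_rangeD[OF zero \<eta>(1)] by auto
  have Sv: "m \<le> nm (S v)" using A_min_modulus_le[OF v(1)] by (simp add: m_def)
  define N where "N = (nm (S v))\<^sup>2"
  have N: "m\<^sup>2 \<le> N" "0 < N" unfolding N_def using Sv m by (auto intro: power_mono)
  have "ip (R v) (S v) = (ip (T v) (S v) / of_real N - t0) * of_real N"
    using N by (simp add: R_def ip_diff_scaleC_left ip_self N_def field_simps)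
  then have cm: "cmod (ip (R v) (S v)) = cmod (ip (T v) (S v) / of_real N - t0) * N"
    using N by (simp add: norm_mult)
  have "(cmod (ip (T v) (S v) / of_real N - t0))\<^sup>2 * N = (cmod (ip (R v) (S v)))\<^sup>2 / N"
    using N unfolding cm by (simp add: power2_eq_square)
  also have "\<dots> \<le> (m * sqrt (e / 2))\<^sup>2 / m\<^sup>2"
    using v(3) \<eta> m N by (intro frac_le power_mono) auto
  also have "\<dots> = e / 2"
    using m e by (simp add: power_mult_distrib)
  finally have "(cmod (ip (T v) (S v) / of_real N - t0))\<^sup>2 * N \<le> e / 2" .
  then have "(A_opnorm A R)\<^sup>2 - e \<le> residual T S v"
    using v(2) \<eta>(2) unfolding residual_eq[OF assms(4) v(1), of T t0] N_def R_def by linarith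
  also have "\<dots> \<le> (SUP v\<in>{v. nm v = 1}. residual T S v)"
    using v(1) by (intro cSUP_upper bdd_above_residual[OF T]) auto
  finally show "(A_opnorm A (\<lambda>x. T x - t0 *\<^sub>C S x))\<^sup>2 \<le> (SUP v\<in>{v. nm v = 1}. residual T S v) + e"
    by (simp add: R_def)
qed

text \<open>The squared error of the coefficient, times \<open>(nm (S (x n)))\<^sup>2\<close>, is at
  most the gap between the supremum and the residual at \<open>x n\<close>. The gap tends to 0 and
  the factor is bounded below by the squared minimum modulus.\<close>

lemma tendsto_minimizer:
  assumes T: "A_bounded A T" and S: "A_bounded A S" and m: "0 < A_min_modulus A S"
    and min: "\<And>t. A_opnorm A (\<lambda>x. T x - t0 *\<^sub>C S x) \<le> A_opnorm A (\<lambda>x. T x - t *\<^sub>C S x)"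
    and x: "\<And>n. nm (x n) = 1"
    and lim: "(\<lambda>n. residual T S (x n)) \<longlonglongrightarrow> (SUP v\<in>{v. nm v = 1}. residual T S v)"
  shows "(\<lambda>n. ip (T (x n)) (S (x n)) / complex_of_real ((nm (S (x n)))\<^sup>2)) \<longlonglongrightarrow> t0"
proof -
  define c where "c = (\<lambda>n. cmod (ip (T (x n)) (S (x n)) / complex_of_real ((nm (S (x n)))\<^sup>2) - t0))"
  define \<mu> where "\<mu> = A_min_modulus A S"
  define L where "L = (SUP v\<in>{v. nm v = 1}. residual T S v)"
  have \<mu>: "0 < \<mu>" using m by (simp add: \<mu>_def)
  have bound: "(c n)\<^sup>2 \<le> (L - residual T S (x n)) / \<mu>\<^sup>2" for n
  proof -
    have "nm (T (x n) - t0 *\<^sub>C S (x n)) \<le> A_opnorm A (\<lambda>x. T x - t0 *\<^sub>C S x)"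
      using nm_le_A_opnorm[OF A_bounded_diff_scaleC[OF T S] x] .
    then have "(nm (T (x n) - t0 *\<^sub>C S (x n)))\<^sup>2 \<le> (A_opnorm A (\<lambda>x. T x - t0 *\<^sub>C S x))\<^sup>2"
      by (simp add: power_mono)
    also have "\<dots> \<le> L"
      unfolding L_def by (rule A_opnorm_sq_le_SUP_residual[OF T S x m min])
    finally have "(c n)\<^sup>2 * (nm (S (x n)))\<^sup>2 \<le> L - residual T S (x n)"
      unfolding residual_eq[OF m x, of T _ t0] c_def by linarith
    moreover have "(c n)\<^sup>2 * \<mu>\<^sup>2 \<le> (c n)\<^sup>2 * (nm (S (x n)))\<^sup>2"
      using A_min_modulus_le[OF x] \<mu> by (intro mult_left_mono power_mono) (auto simp: \<mu>_def)
    ultimately show ?thesis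
      using \<mu> by (simp add: pos_le_divide_eq)
  qed
  have "(\<lambda>n. (L - residual T S (x n)) / \<mu>\<^sup>2) \<longlonglongrightarrow> (L - L) / \<mu>\<^sup>2"
    using lim \<mu> unfolding L_def[symmetric] by (intro tendsto_intros) auto
  then have upper: "(\<lambda>n. (L - residual T S (x n)) / \<mu>\<^sup>2) \<longlonglongrightarrow> 0"
    by simp
  have "(\<lambda>n. (c n)\<^sup>2) \<longlonglongrightarrow> 0"
  proof (rule tendsto_sandwich[OF _ _ tendsto_const upper])
    show "\<forall>\<^sub>F n in sequentially. 0 \<le> (c n)\<^sup>2"
      by simp
    show "\<forall>\<^sub>F n in sequentially. (c n)\<^sup>2 \<le> (L - residual T S (x n)) / \<mu>\<^sup>2"
      by (intro always_eventually allI bound)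
  qed
  then have "(\<lambda>n. sqrt ((c n)\<^sup>2)) \<longlonglongrightarrow> sqrt 0"
    by (rule tendsto_real_sqrt)
  then have "c \<longlonglongrightarrow> 0"
    by (simp add: tendsto_rabs_zero_iff)
  then show ?thesis
    unfolding c_def by (rule LIM_zero_cancel[OF tendsto_norm_zero_cancel])
qed

section \<open>Existence and characterisation of best approximations\<close>

text \<open>The operator seminorm of \<open>T - t S\<close> is Lipschitz in \<open>t\<close> and,
  tested on \<open>u\<close>, at least \<open>cmod t * nm (S u) - nm (T u)\<close>. Hence a minimum
  over a large enough closed disc is global.\<close>

lemma minimizer_exists:
  assumes T: "A_bounded A T" and S: "A_bounded A S" and unit: "nm u = 1"
    and m: "0 < A_min_modulus A S"
  obtains t0 where "\<And>t. A_opnorm A (\<lambda>x. T x - t0 *\<^sub>C S x) \<le> A_opnorm A (\<lambda>x. T x - t *\<^sub>C S x)"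
proof -
  define g where "g t = A_opnorm A (\<lambda>x. T x - t *\<^sub>C S x)" for t
  define s where "s = A_opnorm A S"
  have s: "0 \<le> s" unfolding s_def by (rule A_opnorm_nonneg[OF unit S])
  have g_le: "g t \<le> g t' + cmod (t - t') * s" for t t'
    unfolding g_def
  proof (rule A_opnorm_le[OF unit])
    fix x assume x: "nm x = 1"
    have "T x - t *\<^sub>C S x = (T x - t' *\<^sub>C S x) + (t' - t) *\<^sub>C S x"
      using scaleC_add_left[of "t' - t" t "S x"] by (simp add: algebra_simps)
    then have "nm (T x - t *\<^sub>C S x) = nm ((T x - t' *\<^sub>C S x) + (t' - t) *\<^sub>C S x)"
      by (rule arg_cong)
    also have "\<dots> \<le> nm (T x - t' *\<^sub>C S x) + cmod (t' - t) * nm (S x)"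
      using nm_triangle unfolding nm_scaleC[symmetric] .
    also have "\<dots> \<le> A_opnorm A (\<lambda>x. T x - t' *\<^sub>C S x) + cmod (t' - t) * s"
      unfolding s_def
      by (intro add_mono mult_left_mono nm_le_A_opnorm[OF A_bounded_diff_scaleC[OF T S] x]
          nm_le_A_opnorm[OF S x]) simp
    finally show "nm (T x - t *\<^sub>C S x) \<le> A_opnorm A (\<lambda>x. T x - t' *\<^sub>C S x) + cmod (t - t') * s"
      by (simp add: norm_minus_commute)
  qed
  have "s-lipschitz_on UNIV g"
  proof (rule lipschitz_onI[OF _ s])
    fix t t' :: complex
    show "dist (g t) (g t') \<le> s * dist t t'"
      using g_le[of t t'] g_le[of t' t]
      by (simp add: dist_real_def dist_norm norm_minus_commute mult.commute abs_le_iff)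
  qed
  then have cont: "continuous_on UNIV g"
    by (rule lipschitz_on_continuous_on)
  define \<mu> where "\<mu> = A_min_modulus A S"
  \<comment> \<open>From this radius on, \<open>cmod t * \<mu> - nm (T u)\<close> is at least
    \<open>g 0\<close>.\<close>
  define r where "r = (g 0 + nm (T u)) / \<mu>"
  have \<mu>: "0 < \<mu>" using m by (simp add: \<mu>_def)
  have g0: "0 \<le> g 0"
    unfolding g_def by (rule A_opnorm_nonneg[OF unit A_bounded_diff_scaleC[OF T S]])
  have coercive: "g 0 \<le> g t" if "r \<le> cmod t" for t
  proof -
    have "t *\<^sub>C S u = T u + (- 1) *\<^sub>C (T u - t *\<^sub>C S u)"
      using scaleC_of_real[of "-1" "T u - t *\<^sub>C S u"] by simp
    then have "nm (t *\<^sub>C S u) = nm (T u + (- 1) *\<^sub>C (T u - t *\<^sub>C S u))"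
      by (rule arg_cong)
    also have "\<dots> \<le> nm (T u) + nm ((- 1) *\<^sub>C (T u - t *\<^sub>C S u))"
      by (rule nm_triangle)
    finally have "cmod t * nm (S u) \<le> nm (T u) + nm (T u - t *\<^sub>C S u)"
      by (simp only: nm_scaleC norm_minus_cancel norm_one mult_1)
    also have "\<dots> \<le> nm (T u) + g t"
      unfolding g_def using nm_le_A_opnorm[OF A_bounded_diff_scaleC[OF T S] unit] by simp
    finally have "cmod t * nm (S u) \<le> nm (T u) + g t" .
    moreover have "cmod t * \<mu> \<le> cmod t * nm (S u)"
      unfolding \<mu>_def by (intro mult_left_mono A_min_modulus_le unit) simp
    moreover have "g 0 + nm (T u) \<le> cmod t * \<mu>"
      using that \<mu> by (simp add: r_def pos_divide_le_eq)
    ultimately show ?thesis by linarith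
  qed
  have "0 \<le> r" using g0 \<mu> by (simp add: r_def)
  then obtain t0 where t0: "\<forall>t\<in>cball 0 r. g t0 \<le> g t"
    using continuous_attains_inf[of "cball 0 r" g] continuous_on_subset[OF cont, of "cball 0 r"]
    by auto
  have "g t0 \<le> g t" for t
  proof (cases "cmod t \<le> r")
    case True
    then show ?thesis using t0 by simp
  next
    case False
    have "g t0 \<le> g 0" using t0 \<open>0 \<le> r\<close> by simp
    then show ?thesis using coercive[of t] False by linarith
  qed
  then show ?thesis unfolding g_def by (rule that)
qed

text \<open>\<open>A_dist\<close> is written with a plus sign and \<open>A_center\<close> with a
  minus sign; negation permutes the scalars.\<close>

lemma A_dist_eq: "A_dist A T S = (INF t. A_opnorm A (\<lambda>x. T x - t *\<^sub>C S x))"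
proof -
  have "range (\<lambda>\<gamma>. A_opnorm A (\<lambda>x. T x + \<gamma> *\<^sub>C S x))
      = (\<lambda>\<gamma>. A_opnorm A (\<lambda>x. T x + \<gamma> *\<^sub>C S x)) ` range uminus"
    by (simp add: surj_uminus)
  then show ?thesis
    unfolding A_dist_def by (simp only: image_image diff_scaleC)
qed

text \<open>Links the defining equation of \<open>A_center\<close> with the minimality used so far;
  the values are bounded below by 0, so the infimum is a true lower bound.\<close>

lemma A_opnorm_eq_A_dist_iff:
  assumes T: "A_bounded A T" and S: "A_bounded A S" and unit: "nm u = 1"
  shows "A_opnorm A (\<lambda>x. T x - t0 *\<^sub>C S x) = A_dist A T S
    \<longleftrightarrow> (\<forall>t. A_opnorm A (\<lambda>x. T x - t0 *\<^sub>C S x) \<le> A_opnorm A (\<lambda>x. T x - t *\<^sub>C S x))"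
proof -
  have bdd: "bdd_below (range (\<lambda>t. A_opnorm A (\<lambda>x. T x - t *\<^sub>C S x)))"
    by (intro bdd_belowI2[where m = 0] A_opnorm_nonneg[OF unit] A_bounded_diff_scaleC T S)
  show ?thesis
    unfolding A_dist_eq
  proof
    assume "A_opnorm A (\<lambda>x. T x - t0 *\<^sub>C S x) = (INF t. A_opnorm A (\<lambda>x. T x - t *\<^sub>C S x))"
    then show "\<forall>t. A_opnorm A (\<lambda>x. T x - t0 *\<^sub>C S x) \<le> A_opnorm A (\<lambda>x. T x - t *\<^sub>C S x)"
      using cINF_lower[OF bdd] by simp
  next
    assume "\<forall>t. A_opnorm A (\<lambda>x. T x - t0 *\<^sub>C S x) \<le> A_opnorm A (\<lambda>x. T x - t *\<^sub>C S x)"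
    then show "A_opnorm A (\<lambda>x. T x - t0 *\<^sub>C S x) = (INF t. A_opnorm A (\<lambda>x. T x - t *\<^sub>C S x))"
      by (intro antisym cINF_greatest cINF_lower[OF bdd]) auto
  qed
qed

end

theorem theorem4p2:
  fixes A T S :: "'a::chilbert_space \<Rightarrow> 'a" and x :: "nat \<Rightarrow> 'a"
  assumes nontrivial: "\<exists>v::'a. v \<noteq> 0"
    and A_bounded_op: "bounded_clinear A"
    and A_pos: "positive_op A"
    and A_nonzero: "A \<noteq> (\<lambda>v. 0)"
    and T: "A_bounded A T"
    and S: "A_bounded A S"
    and S_min: "A_min_modulus A S > 0"
    and x_unit: "\<And>n. A_norm A (x n) = 1"
    and x_approx:
      "(\<lambda>n. (A_norm A (T (x n)))\<^sup>2
              - (cmod (A_inner A (T (x n)) (S (x n))))\<^sup>2 / (A_norm A (S (x n)))\<^sup>2)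
        \<longlonglongrightarrow> (SUP v\<in>{v. A_norm A v = 1}.
              (A_norm A (T v))\<^sup>2
                - (cmod (A_inner A (T v) (S v)))\<^sup>2 / (A_norm A (S v))\<^sup>2)"
  shows "(\<lambda>n. A_inner A (T (x n)) (S (x n)) / complex_of_real ((A_norm A (S (x n)))\<^sup>2))
           \<longlonglongrightarrow> A_center A T S"
proof -
  interpret positive_operator A
    using A_bounded_op A_pos by unfold_locales
  have lim: "(\<lambda>n. residual T S (x n)) \<longlonglongrightarrow> (SUP v\<in>{v. nm v = 1}. residual T S v)"
    using x_approx unfolding residual_def .
  let ?q = "\<lambda>n. ip (T (x n)) (S (x n)) / complex_of_real ((nm (S (x n)))\<^sup>2)"
  let ?min = "\<lambda>t. A_opnorm A (\<lambda>x. T x - t *\<^sub>C S x) = A_dist A T S"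
  \<comment> \<open>Shown for every minimiser: two of them are limits of one sequence and so
    coincide, which is the uniqueness that \<open>THE\<close> in \<open>A_center\<close>
    requires.\<close>
  have tends: "?q \<longlonglongrightarrow> t" if "?min t" for t
    using tendsto_minimizer[OF T S S_min _ x_unit lim] that
    unfolding A_opnorm_eq_A_dist_iff[OF T S x_unit[of 0]] by blast
  obtain t0 where t0: "?min t0"
    using minimizer_exists[OF T S x_unit[of 0] S_min]
    unfolding A_opnorm_eq_A_dist_iff[OF T S x_unit[of 0]] by metis
  have "A_center A T S = t0"
    unfolding A_center_def
    using t0 tends LIMSEQ_unique by (intro the_equality) blast+
  then show ?thesis
    using tends[OF t0] by simp
qed

end
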